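(* Let $n\ge 2$ be an integer, let $p:E\to B$ be a fibration and let $\tilde{p}: \tilde{E}\to \tilde{B}$ be the pullback fibration of $p$ along a continuous map $\tilde{B}\to B$. Then $$\mathrm{TC}_n[\tilde{p}:\tilde{E}\to \tilde{B} ]\leq \mathrm{TC}_n[p:E\to B].$$
   Context: For a fibration $p:E\to B$, let $E^n_B=\{(e_1,\dots,e_n)\in E^n\mid p(e_1)=\dots=p(e_n)\}$, and let $E^I_B$ be the subspace of the path space $E^I$ (compact-open topology, $I=[0,1]$) consisting of the paths $\gamma$ with $p\circ\gamma$ constant. Let $\Pi_n:E^I_B\to E^n_B$ be the fibration $$\Pi_n(\gamma)=\Big(\gamma(0),\gamma\big(\tfrac{1}{n-1}\big),\dots,\gamma\big(\tfrac{n-2}{n-1}\big),\gamma(1)\Big).$$ The sequential parametrized topological complexity $\mathrm{TC}_n[p:E\to B]$ is the least integer $r\ge 0$ such that $E^n_B$ has an open cover $\{U_0,\dots,U_r\}$ with each $U_i$ admitting a continuous section of $\Pi_n$ ($\infty$ if there is no such $r$). *)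

theory Defs
  imports "HOL-Analysis.Analysis" "HOL-Library.Extended_Nat"
begin

abbreviation unit_interval :: "real topology" where
  "unit_interval \<equiv> top_of_set {0..1}"

section \<open>Mapping spaces and fibrations\<close>

text \<open>
  Points of a mapping space are required to be \<^const>\<open>extensional\<close>, so that two of them are equal
  iff they agree on the domain \<^term>\<open>topspace X\<close>.
\<close>

definition compact_open_topology :: "'a topology \<Rightarrow> 'b topology \<Rightarrow> ('a \<Rightarrow> 'b) topology" where
  "compact_open_topology X Y =
     topology_generated_by
       {{f \<in> extensional (topspace X). continuous_map X Y f \<and> f ` K \<subseteq> U} |K U.
          compactin X K \<and> openin Y U}"

abbreviation path_space :: "'a topology \<Rightarrow> (real \<Rightarrow> 'a) topology" where
  "path_space E \<equiv> compact_open_topology unit_interval E"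

definition homotopy_lifting_property ::
    "'x topology \<Rightarrow> 'e topology \<Rightarrow> 'b topology \<Rightarrow> ('e \<Rightarrow> 'b) \<Rightarrow> bool" where
  "homotopy_lifting_property X E B p \<longleftrightarrow>
     (\<forall>h g. continuous_map (prod_topology X unit_interval) B h \<and> continuous_map X E g \<and>
            (\<forall>x \<in> topspace X. p (g x) = h (x, 0)) \<longrightarrow>
        (\<exists>H. continuous_map (prod_topology X unit_interval) E H \<and>
             (\<forall>x \<in> topspace X. H (x, 0) = g x) \<and>
             (\<forall>x \<in> topspace X. \<forall>t \<in> {0..1}. p (H (x, t)) = h (x, t))))"

text \<open>
  Hurewicz fibrations. A formula of HOL cannot quantify over types, so the test spaces \<open>X\<close> are
  quantified over one type that is large enough to carry the mapping path space of \<open>p\<close>. This is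
  no restriction: by \<open>hurewicz_fibration_lifts\<close> below, the homotopy lifting property then holds for
  all topological spaces, over every type.
\<close>

definition hurewicz_fibration :: "'e topology \<Rightarrow> 'b topology \<Rightarrow> ('e \<Rightarrow> 'b) \<Rightarrow> bool" where
  "hurewicz_fibration E B p \<longleftrightarrow>
     continuous_map E B p \<and>
     (\<forall>X :: ('e \<times> (real \<Rightarrow> 'b)) topology. homotopy_lifting_property X E B p)"

definition pullback_space ::
    "'c topology \<Rightarrow> ('c \<Rightarrow> 'b) \<Rightarrow> 'e topology \<Rightarrow> ('e \<Rightarrow> 'b) \<Rightarrow> ('c \<times> 'e) topology" where
  "pullback_space C f E p = subtopology (prod_topology C E) {(c, e). f c = p e}"

section \<open>Sequential parametrized topological complexity\<close>

text \<open>
  The base space does not occur as an argument: the spaces \<open>E\<^sup>n\<^sub>B\<close> and \<open>E\<^sup>I\<^sub>B\<close> depend on it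
  only through the map \<open>p\<close>. The components of an \<open>n\<close>-tuple are indexed by \<open>0, \<dots>, n - 1\<close>.
\<close>

definition fibre_power :: "nat \<Rightarrow> 'e topology \<Rightarrow> ('e \<Rightarrow> 'b) \<Rightarrow> (nat \<Rightarrow> 'e) topology" where
  "fibre_power n E p =
     subtopology (product_topology (\<lambda>_. E) {..<n}) {e. \<forall>i<n. \<forall>j<n. p (e i) = p (e j)}"

definition fibre_path_space :: "'e topology \<Rightarrow> ('e \<Rightarrow> 'b) \<Rightarrow> (real \<Rightarrow> 'e) topology" where
  "fibre_path_space E p =
     subtopology (path_space E) {\<gamma>. \<forall>s\<in>{0..1}. \<forall>t\<in>{0..1}. p (\<gamma> s) = p (\<gamma> t)}"

definition path_evaluation :: "nat \<Rightarrow> (real \<Rightarrow> 'e) \<Rightarrow> nat \<Rightarrow> 'e" where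
  "path_evaluation n \<gamma> = (\<lambda>i\<in>{..<n}. \<gamma> (real i / real (n - 1)))"

definition has_section_cover :: "nat \<Rightarrow> 'e topology \<Rightarrow> ('e \<Rightarrow> 'b) \<Rightarrow> nat \<Rightarrow> bool" where
  "has_section_cover n E p r \<longleftrightarrow>
     (\<exists>U :: nat \<Rightarrow> (nat \<Rightarrow> 'e) set.
        (\<forall>i\<le>r. openin (fibre_power n E p) (U i)) \<and>
        (\<Union>i\<le>r. U i) = topspace (fibre_power n E p) \<and>
        (\<forall>i\<le>r. \<exists>s. continuous_map (subtopology (fibre_power n E p) (U i)) (fibre_path_space E p) s \<and>
                    (\<forall>e\<in>U i. path_evaluation n (s e) = e)))"

definition parametrized_TC :: "nat \<Rightarrow> 'e topology \<Rightarrow> ('e \<Rightarrow> 'b) \<Rightarrow> enat" where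
  "parametrized_TC n E p =
     (if \<exists>r. has_section_cover n E p r then enat (LEAST r. has_section_cover n E p r) else \<infinity>)"

section \<open>Adequacy of the definitions\<close>

lemma topspace_compact_open_topology:
  "topspace (compact_open_topology X Y) = {f \<in> extensional (topspace X). continuous_map X Y f}"
proof -
  have "f \<in> topspace (compact_open_topology X Y)"
    if "f \<in> extensional (topspace X)" "continuous_map X Y f" for f
    unfolding compact_open_topology_def topology_generated_by_topspace
    using that by (intro UnionI[of "{f \<in> extensional (topspace X). continuous_map X Y f \<and> f ` {} \<subseteq> {}}"])
      (auto intro!: exI[of _ "{}"])
  then show ?thesis
    by (auto simp: compact_open_topology_def)
qed

lemma continuous_map_into_compact_open:
  assumes h: "continuous_map (prod_topology Z X) Y h"
  shows "continuous_map Z (compact_open_topology X Y) (\<lambda>z. \<lambda>x\<in>topspace X. h (z, x))"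
proof -
  let ?k = "\<lambda>z. \<lambda>x\<in>topspace X. h (z, x)"
  have cont: "continuous_map X Y (?k z)" if "z \<in> topspace Z" for z
  proof -
    have "continuous_map X (prod_topology Z X) (\<lambda>x. (z, x))"
      using that by (simp add: continuous_map_pairwise o_def)
    from continuous_map_compose[OF this h] show ?thesis
      by (rule continuous_map_eq) auto
  qed
  have op: "openin Z {z \<in> topspace Z. ?k z ` K \<subseteq> U}" if K: "compactin X K" and U: "openin Y U" for K U
  proof -
    have KX: "K \<subseteq> topspace X" using K compactin_subset_topspace by blast
    let ?W = "prod_topology Z (subtopology X K)"
    have "compact_space (subtopology X K)" using K by (simp add: compact_space_subtopology)
    then have cl: "closed_map ?W Z fst" by (rule closed_map_fst)
    have "continuous_map ?W Y h"
      using h by (metis continuous_map_from_subtopology prod_topology_subtopology(2))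
    then have "closedin ?W {w \<in> topspace ?W. h w \<in> topspace Y - U}"
      using U by (intro closedin_continuous_map_preimage) auto
    then have c: "closedin Z (fst ` {w \<in> topspace ?W. h w \<in> topspace Y - U})"
      using cl by (auto simp: closed_map_def)
    have hY: "h (z, x) \<in> topspace Y" if "z \<in> topspace Z" "x \<in> topspace X" for z x
      using h that by (auto simp: continuous_map_def)
    have "{z \<in> topspace Z. ?k z ` K \<subseteq> U} =
          topspace Z - fst ` {w \<in> topspace ?W. h w \<in> topspace Y - U}"
    proof (intro set_eqI iffI)
      fix z assume "z \<in> {z \<in> topspace Z. ?k z ` K \<subseteq> U}"
      then show "z \<in> topspace Z - fst ` {w \<in> topspace ?W. h w \<in> topspace Y - U}"
        using KX by force
    next
      fix z assume z: "z \<in> topspace Z - fst ` {w \<in> topspace ?W. h w \<in> topspace Y - U}"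
      have "h (z, x) \<in> U" if "x \<in> K" for x
      proof (rule ccontr)
        assume "h (z, x) \<notin> U"
        then have "(z, x) \<in> {w \<in> topspace ?W. h w \<in> topspace Y - U}"
          using z that KX hY[of z x] by auto
        then have "z \<in> fst ` {w \<in> topspace ?W. h w \<in> topspace Y - U}" by force
        with z show False by blast
      qed
      then show "z \<in> {z \<in> topspace Z. ?k z ` K \<subseteq> U}" using z KX by auto
    qed
    then show ?thesis using c by auto
  qed
  show ?thesis
    unfolding compact_open_topology_def
  proof (rule continuous_on_generated_topo)
    fix S assume "S \<in> {{f \<in> extensional (topspace X). continuous_map X Y f \<and> f ` K \<subseteq> U} |K U.
          compactin X K \<and> openin Y U}"
    then obtain K U where KU: "compactin X K" "openin Y U"
      and S: "S = {f \<in> extensional (topspace X). continuous_map X Y f \<and> f ` K \<subseteq> U}" by auto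
    have "?k -` S \<inter> topspace Z = {z \<in> topspace Z. ?k z ` K \<subseteq> U}"
      using cont unfolding S by auto
    then show "openin Z (?k -` S \<inter> topspace Z)" using op[OF KU] by simp
  next
    show "?k ` topspace Z \<subseteq> \<Union>{{f \<in> extensional (topspace X). continuous_map X Y f \<and> f ` K \<subseteq> U} |K U.
          compactin X K \<and> openin Y U}"
      using cont topspace_compact_open_topology[of X Y]
      by (auto simp: compact_open_topology_def)
  qed
qed

lemma continuous_map_path_eval:
  "continuous_map (prod_topology (path_space E) unit_interval) E (\<lambda>(\<gamma>, t). \<gamma> t)"
  unfolding continuous_map_def
proof (intro conjI allI impI)
  show "(\<lambda>(\<gamma>, t). \<gamma> t) \<in> topspace (prod_topology (path_space E) unit_interval) \<rightarrow> topspace E"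
  proof
    fix x assume "x \<in> topspace (prod_topology (path_space E) unit_interval)"
    then obtain \<gamma> t where x: "x = (\<gamma>, t)" "continuous_map unit_interval E \<gamma>" "t \<in> {0..1}"
      unfolding topspace_prod_topology topspace_compact_open_topology by auto
    show "(case x of (\<gamma>, t) \<Rightarrow> \<gamma> t) \<in> topspace E"
      using continuous_map_funspace[OF x(2)] x(1,3) by auto
  qed
next
  fix U assume U: "openin E U"
  show "openin (prod_topology (path_space E) unit_interval)
          {x \<in> topspace (prod_topology (path_space E) unit_interval). (case x of (\<gamma>, t) \<Rightarrow> \<gamma> t) \<in> U}"
    unfolding openin_prod_topology_alt
  proof (intro allI impI, goal_cases)
    case (1 \<gamma> t)
    then have g: "\<gamma> \<in> extensional {0..1}" "continuous_map unit_interval E \<gamma>" "t \<in> {0..1}" "\<gamma> t \<in> U"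
      unfolding mem_Collect_eq topspace_prod_topology topspace_compact_open_topology by auto
    have "openin unit_interval {s \<in> {0..1}. \<gamma> s \<in> U}"
      using openin_continuous_map_preimage[OF g(2) U] by simp
    then obtain d where d: "d > 0" "cball t d \<inter> {0..1} \<subseteq> {s \<in> {0..1}. \<gamma> s \<in> U}"
      using g(3,4) by (auto simp: openin_contains_cball)
    let ?K = "cball t d \<inter> {0..1}"
    let ?N = "{f \<in> extensional (topspace unit_interval). continuous_map unit_interval E f \<and> f ` ?K \<subseteq> U}"
    have "compactin unit_interval ?K" by (auto simp: compactin_subtopology compact_Int)
    then have "openin (path_space E) ?N"
      unfolding compact_open_topology_def using U by (intro topology_generated_by_Basis) blast
    moreover have "openin unit_interval (ball t d \<inter> {0..1})"
      by (metis Int_commute open_ball openin_open_Int)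
    moreover have "\<gamma> \<in> ?N" using g d by auto
    moreover have "t \<in> ball t d \<inter> {0..1}" using d g by auto
    moreover have "?N \<times> (ball t d \<inter> {0..1}) \<subseteq>
        {x \<in> topspace (prod_topology (path_space E) unit_interval). (case x of (\<gamma>, t) \<Rightarrow> \<gamma> t) \<in> U}"
      unfolding topspace_prod_topology topspace_compact_open_topology by auto
    ultimately show ?case by blast
  qed
qed

theorem hurewicz_fibration_lifts:
  fixes X :: "'x topology" and E :: "'e topology" and B :: "'b topology"
  assumes "hurewicz_fibration E B p"
  shows "homotopy_lifting_property X E B p"
  unfolding homotopy_lifting_property_def
proof (intro allI impI, elim conjE)
  fix h :: "'x \<times> real \<Rightarrow> 'b" and g :: "'x \<Rightarrow> 'e"
  assume h: "continuous_map (prod_topology X unit_interval) B h"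
    and g: "continuous_map X E g"
    and hg: "\<forall>x\<in>topspace X. p (g x) = h (x, 0)"
  define M where "M = subtopology (prod_topology E (path_space B)) {(e, \<gamma>). p e = \<gamma> 0}"
  define k where "k x = (g x, \<lambda>t\<in>{0..1}. h (x, t))" for x
  have fstM: "continuous_map M E fst"
    unfolding M_def by (simp add: continuous_map_from_subtopology continuous_map_fst)
  have sndM: "continuous_map M (path_space B) snd"
    unfolding M_def by (simp add: continuous_map_from_subtopology continuous_map_snd)
  have "continuous_map (prod_topology M unit_interval) (prod_topology (path_space B) unit_interval)
          (\<lambda>(m, t). (snd m, t))"
    using continuous_map_compose[OF continuous_map_fst sndM]
    by (auto simp: continuous_map_pairwise o_def case_prod_beta continuous_map_snd)
  from continuous_map_compose[OF this continuous_map_path_eval]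
  have ev: "continuous_map (prod_topology M unit_interval) B (\<lambda>(m, t). snd m t)"
    by (simp add: o_def case_prod_unfold)
  have hlp: "homotopy_lifting_property M E B p"
    using assms by (simp add: hurewicz_fibration_def)
  have start: "\<forall>m\<in>topspace M. p (fst m) = (\<lambda>(m, t). snd m t) (m, 0)"
    by (auto simp: M_def)
  obtain H where H: "continuous_map (prod_topology M unit_interval) E H"
      "\<forall>m\<in>topspace M. H (m, 0) = fst m"
      "\<forall>m\<in>topspace M. \<forall>t\<in>{0..1}. p (H (m, t)) = snd m t"
    using hlp[unfolded homotopy_lifting_property_def, rule_format, OF conjI[OF ev conjI[OF fstM]]] start
    by (auto simp: Ball_def)
  have "continuous_map X (prod_topology E (path_space B)) k"
    using g continuous_map_into_compact_open[OF h]
    by (simp add: continuous_map_pairwise k_def o_def)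
  then have k: "continuous_map X M k"
    unfolding M_def using hg by (auto simp: continuous_map_in_subtopology k_def)
  have "continuous_map (prod_topology X unit_interval) (prod_topology M unit_interval)
          (\<lambda>(x, t). (k x, t))"
    using continuous_map_compose[OF continuous_map_fst k]
    by (auto simp: continuous_map_pairwise o_def case_prod_beta continuous_map_snd)
  from continuous_map_compose[OF this H(1)]
  have "continuous_map (prod_topology X unit_interval) E (\<lambda>(x, t). H (k x, t))"
    by (simp add: o_def case_prod_unfold)
  moreover have "k x \<in> topspace M" if "x \<in> topspace X" for x
    using k that by (auto simp: continuous_map_def)
  ultimately show "\<exists>H. continuous_map (prod_topology X unit_interval) E H \<and>
           (\<forall>x\<in>topspace X. H (x, 0) = g x) \<and>
           (\<forall>x\<in>topspace X. \<forall>t\<in>{0..1}. p (H (x, t)) = h (x, t))"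
    using H(2,3) by (intro exI[of _ "\<lambda>(x, t). H (k x, t)"]) (auto simp: k_def)
qed

theorem hurewicz_fibration_pullback:
  fixes E :: "'e topology" and B :: "'b topology" and C :: "'c topology"
  assumes p: "hurewicz_fibration E B p" and f: "continuous_map C B f"
  shows "hurewicz_fibration (pullback_space C f E p) C fst"
  unfolding hurewicz_fibration_def
proof (intro conjI allI)
  show "continuous_map (pullback_space C f E p) C fst"
    unfolding pullback_space_def by (simp add: continuous_map_from_subtopology continuous_map_fst)
next
  fix X :: "(('c \<times> 'e) \<times> (real \<Rightarrow> 'c)) topology"
  show "homotopy_lifting_property X (pullback_space C f E p) C fst"
    unfolding homotopy_lifting_property_def
  proof (intro allI impI, elim conjE)
    fix h g
    assume h: "continuous_map (prod_topology X unit_interval) C h"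
      and g: "continuous_map X (pullback_space C f E p) g"
      and hg: "\<forall>x\<in>topspace X. fst (g x) = h (x, 0)"
    have g2: "continuous_map X E (snd \<circ> g)" "\<And>x. x \<in> topspace X \<Longrightarrow> f (fst (g x)) = p (snd (g x))"
      using g by (auto simp: pullback_space_def continuous_map_in_subtopology continuous_map_pairwise
          case_prod_beta Pi_iff image_subset_iff)
    have "continuous_map (prod_topology X unit_interval) B (f \<circ> h)"
      using h f by (rule continuous_map_compose)
    moreover have "\<forall>x\<in>topspace X. p ((snd \<circ> g) x) = (f \<circ> h) (x, 0)"
      using g2(2) hg by (metis comp_apply)
    ultimately obtain H where H: "continuous_map (prod_topology X unit_interval) E H"
      "\<forall>x\<in>topspace X. H (x, 0) = (snd \<circ> g) x"
      "\<forall>x\<in>topspace X. \<forall>t\<in>{0..1}. p (H (x, t)) = (f \<circ> h) (x, t)"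
      using hurewicz_fibration_lifts[OF p, of X] g2(1)
      unfolding homotopy_lifting_property_def by blast
    have "continuous_map (prod_topology X unit_interval) (pullback_space C f E p) (\<lambda>z. (h z, H z))"
      unfolding pullback_space_def using h H(1,3)
      by (auto simp: continuous_map_in_subtopology continuous_map_pairwise o_def)
    then show "\<exists>H. continuous_map (prod_topology X unit_interval) (pullback_space C f E p) H \<and>
           (\<forall>x\<in>topspace X. H (x, 0) = g x) \<and>
           (\<forall>x\<in>topspace X. \<forall>t\<in>{0..1}. fst (H (x, t)) = h (x, t))"
      using H(2) hg by (intro exI[of _ "\<lambda>z. (h z, H z)"]) (auto simp: prod_eq_iff)
  qed
qed

end

theory Submission
  imports Defs
begin

text \<open>
  The projection \<open>E' \<rightarrow> E\<close> of the pullback induces a map \<open>E'\<^sup>n\<^sub>B\<^sub>' \<rightarrow> E\<^sup>n\<^sub>B\<close>, along which the open cover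
  is pulled back. A section \<open>s\<close> over \<open>U\<close> pulls back as well: a tuple over \<open>b\<close> is sent to the path
  whose first component is constantly \<open>b\<close> and whose second component is the path that \<open>s\<close> assigns
  to the projected tuple.
\<close>

text \<open>The restriction to \<open>{..<n}\<close> is needed because the points of
  \<open>product_topology\<close> are extensional.\<close>

definition snd_tuple :: "nat \<Rightarrow> (nat \<Rightarrow> 'c \<times> 'e) \<Rightarrow> nat \<Rightarrow> 'e" where
  "snd_tuple n e = (\<lambda>i\<in>{..<n}. snd (e i))"

lemma continuous_map_fibre_power_component:
  assumes "i < n"
  shows "continuous_map (fibre_power n E p) E (\<lambda>e. e i)"
  unfolding fibre_power_def using assms
  by (intro continuous_map_from_subtopology continuous_map_product_projection) auto

lemma fibre_power_pullbackD:
  assumes "e \<in> topspace (fibre_power n (pullback_space C f E p) fst)"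
  shows "e \<in> extensional {..<n}"
    and "\<And>i j. i < n \<Longrightarrow> j < n \<Longrightarrow> fst (e i) = fst (e j)"
    and "\<And>i. i < n \<Longrightarrow> p (snd (e i)) = f (fst (e i))"
proof -
  have *: "e \<in> (\<Pi>\<^sub>E i\<in>{..<n}. topspace (pullback_space C f E p))"
    "\<forall>i<n. \<forall>j<n. fst (e i) = fst (e j)"
    using assms unfolding fibre_power_def topspace_subtopology topspace_product_topology by blast+
  then show "e \<in> extensional {..<n}" "\<And>i j. i < n \<Longrightarrow> j < n \<Longrightarrow> fst (e i) = fst (e j)"
    unfolding PiE_iff by blast+
  have "e i \<in> topspace (pullback_space C f E p)" if "i < n" for i
    using *(1) that by blast
  then show "\<And>i. i < n \<Longrightarrow> p (snd (e i)) = f (fst (e i))"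
    by (force simp: pullback_space_def case_prod_beta)
qed

lemma continuous_map_pullback_space_proj:
  "continuous_map (pullback_space C f E p) C fst"
  "continuous_map (pullback_space C f E p) E snd"
  unfolding pullback_space_def
  by (simp_all add: continuous_map_from_subtopology continuous_map_fst continuous_map_snd)

text \<open>Continuity is checked coordinatewise. The image tuple lies in a single fibre of
  \<open>p\<close>: all entries of \<open>e\<close> share one base point c, and membership in the
  pullback gives \<open>p (snd (e i))\<close> = f c for every i.\<close>

lemma continuous_map_snd_tuple:
  "continuous_map (fibre_power n (pullback_space C f E p) fst) (fibre_power n E p) (snd_tuple n)"
    (is "continuous_map ?F _ _")
proof -
  have "continuous_map ?F E (\<lambda>e. snd (e i))" if "i < n" for i
    using continuous_map_compose[OF continuous_map_fibre_power_component[OF that]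
        continuous_map_pullback_space_proj(2)]
    by (simp add: o_def)
  then have "continuous_map ?F (product_topology (\<lambda>_. E) {..<n}) (snd_tuple n)"
    by (simp add: continuous_map_componentwise image_subset_iff snd_tuple_def)
  moreover have "p (snd_tuple n e i) = p (snd_tuple n e j)"
    if "e \<in> topspace ?F" "i < n" "j < n" for e i j
    using fibre_power_pullbackD(2)[OF that]
      fibre_power_pullbackD(3)[OF that(1,2)] fibre_power_pullbackD(3)[OF that(1,3)] that(2,3)
    by (simp add: snd_tuple_def)
  ultimately show ?thesis
    unfolding fibre_power_def[of n E p] continuous_map_in_subtopology by blast
qed

text \<open>Currying into the compact-open topology: a section can thus be built as a map of two
  variables, tuple and time.\<close>

lemma continuous_map_into_fibre_path_space:
  assumes h: "continuous_map (prod_topology Z unit_interval) E h"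
    and "\<And>z s t. z \<in> topspace Z \<Longrightarrow> s \<in> {0..1} \<Longrightarrow> t \<in> {0..1} \<Longrightarrow> p (h (z, s)) = p (h (z, t))"
  shows "continuous_map Z (fibre_path_space E p) (\<lambda>z. \<lambda>t\<in>{0..1}. h (z, t))"
  unfolding fibre_path_space_def
  unfolding continuous_map_in_subtopology
proof
  show "continuous_map Z (path_space E) (\<lambda>z. \<lambda>t\<in>{0..1}. h (z, t))"
    using continuous_map_into_compact_open[OF h] by simp
next
  have "p ((\<lambda>t\<in>{0..1}. h (z, t)) s) = p ((\<lambda>t\<in>{0..1}. h (z, t)) t)"
    if "z \<in> topspace Z" "s \<in> {0..1}" "t \<in> {0..1}" for z s t
    using assms(2)[OF that] that(2,3) by simp
  then show "(\<lambda>z. \<lambda>t\<in>{0..1}. h (z, t)) \<in> topspace Z \<rightarrow>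
      {\<gamma>. \<forall>s\<in>{0..1}. \<forall>t\<in>{0..1}. p (\<gamma> s) = p (\<gamma> t)}"
    by blast
qed

text \<open>The section \<open>s\<close> is uncurried, paired with the base point, shown to land in
  the pullback, and curried again.\<close>

lemma fibre_section_pullback:
  fixes n :: nat and E :: "'e topology" and C :: "'c topology" and p :: "'e \<Rightarrow> 'b" and f :: "'c \<Rightarrow> 'b"
  defines "F \<equiv> fibre_power n (pullback_space C f E p) fst"
  assumes n: "n \<ge> 2"
    and s: "continuous_map (subtopology (fibre_power n E p) U) (fibre_path_space E p) s"
    and ev: "\<forall>e\<in>U. path_evaluation n (s e) = e"
  shows "\<exists>s'. continuous_map (subtopology F {e \<in> topspace F. snd_tuple n e \<in> U})
                (fibre_path_space (pullback_space C f E p) fst) s' \<and>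
              (\<forall>e\<in>{e \<in> topspace F. snd_tuple n e \<in> U}. path_evaluation n (s' e) = e)"
proof -
  define V where "V = {e \<in> topspace F. snd_tuple n e \<in> U}"
  define Z where "Z = subtopology F V"
  \<comment> \<open>Entry 0, available since n \<ge> 2, represents the base point common to all
    entries.\<close>
  define h where "h = (\<lambda>(e :: nat \<Rightarrow> 'c \<times> 'e, t). (fst (e 0), s (snd_tuple n e) t))"
  have Z: "topspace Z = V" "V \<subseteq> topspace F"
    unfolding Z_def V_def by auto
  have "continuous_map Z (subtopology (fibre_power n E p) U) (snd_tuple n)"
    using continuous_map_from_subtopology[OF continuous_map_snd_tuple, of n C f E p V]
    by (auto simp: continuous_map_in_subtopology Z_def F_def V_def)
  from continuous_map_compose[OF this s]
  have sq: "continuous_map Z (fibre_path_space E p) (\<lambda>e. s (snd_tuple n e))"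
    by (simp add: o_def)
  then have path: "continuous_map Z (path_space E) (\<lambda>e. s (snd_tuple n e))"
    by (simp add: fibre_path_space_def continuous_map_in_subtopology)
  have const: "p (s (snd_tuple n e) t) = p (s (snd_tuple n e) 0)" if "e \<in> V" "t \<in> {0..1}" for e t
  proof -
    have "s (snd_tuple n e) \<in> topspace (fibre_path_space E p)"
      using continuous_map_funspace[OF sq] that(1) Z(1) by auto
    then have "\<forall>s'\<in>{0..1}. \<forall>t'\<in>{0..1}. p (s (snd_tuple n e) s') = p (s (snd_tuple n e) t')"
      unfolding fibre_path_space_def topspace_subtopology by blast
    then show ?thesis
      using that(2) by (metis atLeastAtMost_iff order_refl zero_le_one)
  qed
  \<comment> \<open>The section property of \<open>s\<close> read off in coordinate i.\<close>
  have val: "s (snd_tuple n e) (real i / real (n - 1)) = snd (e i)" if "e \<in> V" "i < n" for e i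
  proof -
    have "path_evaluation n (s (snd_tuple n e)) i = snd_tuple n e i"
      using ev that by (simp add: V_def)
    then show ?thesis
      using that by (simp add: path_evaluation_def snd_tuple_def)
  qed
  \<comment> \<open>Uncurrying: composing with the continuous evaluation of paths makes
    \<open>s (snd_tuple n e) t\<close> jointly continuous in e and t.\<close>
  have "continuous_map (prod_topology Z unit_interval) (prod_topology (path_space E) unit_interval)
          (\<lambda>(e, t). (s (snd_tuple n e), t))"
    using continuous_map_compose[OF continuous_map_fst path]
    by (auto simp: continuous_map_pairwise o_def case_prod_beta continuous_map_snd)
  from continuous_map_compose[OF this continuous_map_path_eval]
  have "continuous_map (prod_topology Z unit_interval) E (\<lambda>(e, t). s (snd_tuple n e) t)"
    by (simp add: o_def case_prod_unfold)
  moreover have "continuous_map F C (\<lambda>e. fst (e 0))"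
    using continuous_map_compose[OF continuous_map_fibre_power_component
        continuous_map_pullback_space_proj(1), of 0 n C f E p fst] n
    by (simp add: o_def F_def)
  then have "continuous_map Z C (\<lambda>e. fst (e 0))"
    unfolding Z_def by (rule continuous_map_from_subtopology)
  from continuous_map_compose[OF continuous_map_fst this]
  have "continuous_map (prod_topology Z unit_interval) C (\<lambda>(e, t). fst (e 0))"
    by (simp add: o_def case_prod_unfold)
  \<comment> \<open>The path stays in the fibre of its starting point \<open>snd (e 0)\<close>, and
    that point lies over \<open>f (fst (e 0))\<close> because \<open>e 0\<close> belongs to the
    pullback.\<close>
  moreover have "f (fst (e 0)) = p (s (snd_tuple n e) t)" if "e \<in> V" "t \<in> {0..1}" for e t
  proof -
    have "f (fst (e 0)) = p (snd (e 0))"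
      using fibre_power_pullbackD(3)[of e n C f E p 0] that Z n by (auto simp: F_def)
    then show ?thesis
      using val[OF that(1), of 0] const[OF that] n by simp
  qed
  ultimately have "continuous_map (prod_topology Z unit_interval) (pullback_space C f E p) h"
    unfolding pullback_space_def h_def
    by (auto simp: continuous_map_in_subtopology continuous_map_pairwise o_def case_prod_unfold Z)
  \<comment> \<open>The first component of \<open>h\<close> does not depend on time, so each path
    stays in one fibre of \<open>fst\<close>.\<close>
  then have "continuous_map Z (fibre_path_space (pullback_space C f E p) fst)
      (\<lambda>e. \<lambda>t\<in>{0..1}. h (e, t))"
    by (rule continuous_map_into_fibre_path_space) (simp add: h_def)
  moreover have "path_evaluation n (\<lambda>t\<in>{0..1}. h (e, t)) = e" if e: "e \<in> V" for e
  proof (rule extensionalityI)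
    have eF: "e \<in> topspace (fibre_power n (pullback_space C f E p) fst)"
      using e Z by (auto simp: F_def)
    show "path_evaluation n (\<lambda>t\<in>{0..1}. h (e, t)) \<in> extensional {..<n}"
      by (simp add: path_evaluation_def)
    show "e \<in> extensional {..<n}"
      by (rule fibre_power_pullbackD(1)[OF eF])
    fix i assume "i \<in> {..<n}"
    then have i: "i < n" by simp
    \<comment> \<open>The sample times lie in the domain of the restricted path, so its value there
      is that of \<open>h\<close> and not \<open>undefined\<close>.\<close>
    have "real i / real (n - 1) \<in> {0..1}"
      using i n by (auto simp: divide_le_eq_1)
    then show "path_evaluation n (\<lambda>t\<in>{0..1}. h (e, t)) i = e i"
      using i n val[OF e i] fibre_power_pullbackD(2)[OF eF, of 0 i]
      by (simp add: path_evaluation_def h_def prod_eq_iff)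
  qed
  ultimately show ?thesis
    unfolding Z_def V_def by blast
qed

text \<open>Taking preimages under \<open>snd_tuple n\<close> index by index keeps the number of
  open sets, hence the same r on both sides.\<close>

lemma has_section_cover_pullback:
  assumes "n \<ge> 2" and "has_section_cover n E p r"
  shows "has_section_cover n (pullback_space C f E p) fst r"
proof -
  let ?F = "fibre_power n (pullback_space C f E p) fst"
  let ?V = "\<lambda>U. {e \<in> topspace ?F. snd_tuple n e \<in> U}"
  obtain U where U: "\<forall>i\<le>r. openin (fibre_power n E p) (U i)"
    and cover: "(\<Union>i\<le>r. U i) = topspace (fibre_power n E p)"
    and sec: "\<forall>i\<le>r. \<exists>s. continuous_map (subtopology (fibre_power n E p) (U i)) (fibre_path_space E p) s \<and>
                    (\<forall>e\<in>U i. path_evaluation n (s e) = e)"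
    using assms(2) unfolding has_section_cover_def by blast
  have "\<forall>i\<le>r. openin ?F (?V (U i))"
    using U openin_continuous_map_preimage[OF continuous_map_snd_tuple] by blast
  moreover have "(\<Union>i\<le>r. ?V (U i)) = topspace ?F"
  proof -
    have "snd_tuple n e \<in> (\<Union>i\<le>r. U i)" if "e \<in> topspace ?F" for e
      using funcset_mem[OF continuous_map_funspace[OF continuous_map_snd_tuple] that] cover by simp
    then show ?thesis by auto
  qed
  moreover have "\<forall>i\<le>r. \<exists>s. continuous_map (subtopology ?F (?V (U i)))
        (fibre_path_space (pullback_space C f E p) fst) s \<and>
        (\<forall>e\<in>?V (U i). path_evaluation n (s e) = e)"
  proof (intro allI impI)
    fix i assume "i \<le> r"
    with sec obtain s where
      "continuous_map (subtopology (fibre_power n E p) (U i)) (fibre_path_space E p) s"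
      "\<forall>e\<in>U i. path_evaluation n (s e) = e"
      by blast
    then show "\<exists>s. continuous_map (subtopology ?F (?V (U i)))
        (fibre_path_space (pullback_space C f E p) fst) s \<and>
        (\<forall>e\<in>?V (U i). path_evaluation n (s e) = e)"
      by (rule fibre_section_pullback[OF assms(1)])
  qed
  ultimately show ?thesis
    unfolding has_section_cover_def by (intro exI[of _ "\<lambda>i. ?V (U i)"]) simp
qed

theorem lemma2p4:
  fixes n :: nat
    and E :: "'e topology" and B :: "'b topology" and B' :: "'c topology"
    and p :: "'e \<Rightarrow> 'b" and f :: "'c \<Rightarrow> 'b"
  assumes "n \<ge> 2"
    and "hurewicz_fibration E B p"
    and "continuous_map B' B f"
  shows "parametrized_TC n (pullback_space B' f E p) fst \<le> parametrized_TC n E p"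
proof (cases "\<exists>r. has_section_cover n E p r")
  case True
  \<comment> \<open>The least r for \<open>p\<close> is admissible for the pullback and so bounds
    the least one there. If \<open>p\<close> has no admissible r, the right-hand side is
    infinite.\<close>
  then have "has_section_cover n E p (LEAST r. has_section_cover n E p r)"
    by (rule LeastI_ex)
  then have "has_section_cover n (pullback_space B' f E p) fst (LEAST r. has_section_cover n E p r)"
    by (rule has_section_cover_pullback[OF assms(1)])
  then show ?thesis
    using True by (auto simp: parametrized_TC_def intro: Least_le)
qed (simp add: parametrized_TC_def)

end
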